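(* Let $d$ be a positive integer, let $n_1,\ldots,n_d\ge 0$ be fixed real exponents, and let $(X_1,\ldots,X_d)$ be a real random vector such that $\mathbb{E}(|X_1|^{n_1}\cdots|X_d|^{n_d})<\infty$. Let $|\boldsymbol{X}| = (|X_1|,\ldots,|X_d|)$. (i) If $|\boldsymbol{X}|$ is positively upper orthant dependent (PUOD), then $$\mathbb{E}\Big(\prod_{j=1}^d|X_j|^{n_j}\Big)\ \ge\ \prod_{j=1}^d\mathbb{E}\big(|X_j|^{n_j}\big).$$ (ii) If $|\boldsymbol{X}|$ is strongly positively upper orthant dependent (SPUOD), then for every $I\subset\{1,\ldots,d\}$, with $I^c=\{1,\ldots,d\}\setminus I$, $$\mathbb{E}\Big(\prod_{j=1}^d|X_j|^{n_j}\Big)\ \ge\ \mathbb{E}\Big(\prod_{j\in I}|X_j|^{n_j}\Big)\cdot\mathbb{E}\Big(\prod_{j\in I^c}|X_j|^{n_j}\Big).$$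
   Context: A random vector $V=(V_1,\ldots,V_d)\in\mathbb{R}^d$ is positively upper orthant dependent (PUOD) if $$\mathbb{P}(V_1\ge t_1,\ldots,V_d\ge t_d)\ \ge\ \prod_{j=1}^d\mathbb{P}(V_j\ge t_j)\quad\text{for all } t_1,\ldots,t_d\in\mathbb{R}.$$ It is strongly positively upper orthant dependent (SPUOD) if for all $I\subset\{1,\ldots,d\}$, with $I^c=\{1,\ldots,d\}\setminus I$, and all $t_1,\ldots,t_d\in\mathbb{R}$, $$\mathbb{P}(V_1\ge t_1,\ldots,V_d\ge t_d)\ \ge\ \mathbb{P}(V_j\ge t_j\text{ for all }j\in I)\cdot\mathbb{P}(V_j\ge t_j\text{ for all }j\in I^c).$$ Conventions: $x^0=1$ for all $x\ge0$ (including $x=0$); empty products equal $1$ and an empty conjunction of events has probability $1$; expectations of nonnegative random variables are taken in $[0,\infty]$ with $0\cdot\infty=0$. *)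

theory Defs
  imports "HOL-Probability.Probability"
begin

text \<open>A random vector in dimension \<open>d\<close> is a family \<open>V :: nat \<Rightarrow> 'a \<Rightarrow> real\<close> of random variables
  on \<open>M\<close>; only the components \<open>V j\<close> with \<open>j \<in> {1..d}\<close> matter.\<close>

definition random_vector :: "'a measure \<Rightarrow> nat \<Rightarrow> (nat \<Rightarrow> 'a \<Rightarrow> real) \<Rightarrow> bool" where
  "random_vector M d V \<longleftrightarrow> (\<forall>j\<in>{1..d}. V j \<in> borel_measurable M)"

definition PUOD :: "'a measure \<Rightarrow> nat \<Rightarrow> (nat \<Rightarrow> 'a \<Rightarrow> real) \<Rightarrow> bool" where
  "PUOD M d V \<longleftrightarrow> (\<forall>t :: nat \<Rightarrow> real.
     \<P>(\<omega> in M. \<forall>j\<in>{1..d}. V j \<omega> \<ge> t j) \<ge> (\<Prod>j\<in>{1..d}. \<P>(\<omega> in M. V j \<omega> \<ge> t j)))"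

definition SPUOD :: "'a measure \<Rightarrow> nat \<Rightarrow> (nat \<Rightarrow> 'a \<Rightarrow> real) \<Rightarrow> bool" where
  "SPUOD M d V \<longleftrightarrow> (\<forall>I \<subseteq> {1..d}. \<forall>t :: nat \<Rightarrow> real.
     \<P>(\<omega> in M. \<forall>j\<in>{1..d}. V j \<omega> \<ge> t j) \<ge>
     \<P>(\<omega> in M. \<forall>j\<in>I. V j \<omega> \<ge> t j) * \<P>(\<omega> in M. \<forall>j\<in>{1..d} - I. V j \<omega> \<ge> t j))"

text \<open>Real powers of nonnegative reals with \<open>x\<^sup>0 = 1\<close> for every \<open>x\<close>; in the library
  \<open>0 powr 0 = 0\<close>.\<close>

definition rpow :: "real \<Rightarrow> real \<Rightarrow> real" where
  "rpow x a = (if a = 0 then 1 else x powr a)"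

end

theory Submission
  imports Defs
begin

text \<open>
  Each power has a layer representation \<open>x\<^sup>a = \<integral> g(u) 1[x \<ge> s(u)] du\<close>. Both sides of the
  inequality are linear in each single factor, so by Tonelli the threshold indicators in the
  dependence hypothesis can be replaced by such mixtures one coordinate at a time. This works for
  the product over any disjoint family of blocks of coordinates: singletons give PUOD, a set and its
  complement give SPUOD.
\<close>

section \<open>Mixtures of threshold indicators\<close>

text \<open>Here \<open>u\<close> is the layer, \<open>g u\<close> its weight and \<open>s u\<close>
  the threshold that it imposes. Keeping weight and threshold separate lets the constant 1 and a
  power with positive exponent share one form.\<close>

definition layered :: "(real \<Rightarrow> ennreal) \<Rightarrow> (real \<Rightarrow> real) \<Rightarrow> real \<Rightarrow> ennreal" where
  "layered g s x = (\<integral>\<^sup>+u. g u * indicator {s u..} x \<partial>lborel)"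

text \<open>The set \<open>{s z..}\<close> moves with \<open>z\<close>, so the indicator is read as
  a comparison of two measurable functions. On a product space this gives the joint measurability in
  sample point and layer that Tonelli requires.\<close>

lemma measurable_threshold:
  fixes f s :: "'a \<Rightarrow> real"
  assumes [measurable]: "f \<in> borel_measurable N" "s \<in> borel_measurable N"
  shows "(\<lambda>z. indicator {s z..} (f z) :: ennreal) \<in> borel_measurable N"
proof -
  have "(\<lambda>z. indicator {s z..} (f z) :: ennreal) = (\<lambda>z. if s z \<le> f z then 1 else 0)"
    by (auto simp: fun_eq_iff indicator_def)
  then show ?thesis
    by simp
qed

lemma measurable_layered [measurable]:
  assumes [measurable]: "g \<in> borel_measurable borel" "s \<in> borel_measurable borel"
  shows "layered g s \<in> borel_measurable borel"
proof -
  have [measurable]: "(\<lambda>z :: real \<times> real. indicator {s (snd z)..} (fst z) :: ennreal)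
      \<in> borel_measurable (borel \<Otimes>\<^sub>M lborel)"
    by (rule measurable_threshold) measurable
  have "(\<lambda>x. \<integral>\<^sup>+u. g u * indicator {s u..} x \<partial>lborel) \<in> borel_measurable borel"
    by (rule lborel.borel_measurable_nn_integral) (simp add: split_beta')
  then show ?thesis
    unfolding layered_def .
qed

text \<open>Only the factor at \<open>k\<close> involves the layer \<open>u\<close>. The other
  factors are constant in \<open>u\<close>, move under the layer integral, and Tonelli then swaps
  the two integrals. The measurability claim allows a further constant to be moved through the
  integral over \<open>u\<close> later on.\<close>

lemma nn_integral_prod_layered:
  fixes V :: "'i \<Rightarrow> 'a \<Rightarrow> real" and \<phi> :: "'i \<Rightarrow> real \<Rightarrow> ennreal"
  assumes "sigma_finite_measure M" "finite A" "k \<in> A"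
    and V: "\<And>j. j \<in> A \<Longrightarrow> V j \<in> borel_measurable M"
    and \<phi>: "\<And>j. j \<in> A \<Longrightarrow> \<phi> j \<in> borel_measurable borel"
    and g [measurable]: "g \<in> borel_measurable borel"
    and s [measurable]: "s \<in> borel_measurable borel"
  shows "(\<integral>\<^sup>+\<omega>. (\<Prod>j\<in>A. (\<phi>(k := layered g s)) j (V j \<omega>)) \<partial>M) =
    (\<integral>\<^sup>+u. g u * (\<integral>\<^sup>+\<omega>. (\<Prod>j\<in>A. (\<phi>(k := indicator {s u..})) j (V j \<omega>)) \<partial>M) \<partial>lborel)"
    (is "?lhs = ?rhs")
    and "(\<lambda>u. \<integral>\<^sup>+\<omega>. (\<Prod>j\<in>A. (\<phi>(k := indicator {s u..})) j (V j \<omega>)) \<partial>M)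
      \<in> borel_measurable lborel" (is ?meas)
proof -
  interpret sigma_finite_measure M by fact
  interpret pair_sigma_finite M lborel ..
  define R where "R \<omega> = (\<Prod>j\<in>A - {k}. \<phi> j (V j \<omega>))" for \<omega>
  \<comment> \<open>Stated for arbitrary \<open>h\<close>, so that it factors the product with the
    layered function as well as those with the indicators it mixes.\<close>
  have split: "(\<Prod>j\<in>A. (\<phi>(k := h)) j (V j \<omega>)) = h (V k \<omega>) * R \<omega>" for h \<omega>
    using assms(2,3) by (simp add: prod.remove[of A k] R_def)
  have [measurable]: "V k \<in> borel_measurable M"
    using V assms(3) by blast
  have [measurable]: "R \<in> borel_measurable M"
    unfolding R_def
    by (intro borel_measurable_prod_ennreal measurable_compose[OF V \<phi>]) auto
  have thr [measurable]: "(\<lambda>z. indicator {s (snd z)..} (V k (fst z)) :: ennreal)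
      \<in> borel_measurable (M \<Otimes>\<^sub>M lborel)"
    by (rule measurable_threshold) measurable
  have thr' [measurable]: "(\<lambda>z. indicator {s (fst z)..} (V k (snd z)) :: ennreal)
      \<in> borel_measurable (lborel \<Otimes>\<^sub>M M)"
    by (rule measurable_threshold) measurable
  \<comment> \<open>With the sample point fixed, measurability in \<open>u\<close> alone is what
    moving \<open>R \<omega>\<close> under the layer integral needs.\<close>
  have row [measurable]: "(\<lambda>u. indicator {s u..} x :: ennreal) \<in> borel_measurable borel" for x
    by (rule measurable_threshold) measurable
  show ?meas
    unfolding split
    by (rule sigma_finite_measure.borel_measurable_nn_integral[OF assms(1)]) (simp add: split_beta')
  have "?lhs = (\<integral>\<^sup>+\<omega>. (\<integral>\<^sup>+u. g u * indicator {s u..} (V k \<omega>) * R \<omega> \<partial>lborel) \<partial>M)"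
    unfolding split layered_def by (simp add: nn_integral_multc)
  also have "\<dots> = (\<integral>\<^sup>+u. (\<integral>\<^sup>+\<omega>. g u * indicator {s u..} (V k \<omega>) * R \<omega> \<partial>M) \<partial>lborel)"
    by (rule Fubini'[symmetric]) (simp add: split_beta')
  also have "\<dots> = ?rhs"
    unfolding split by (simp add: nn_integral_cmult mult.assoc)
  finally show "?lhs = ?rhs" .
qed

section \<open>Replacing thresholds one coordinate at a time\<close>

text \<open>By disjointness \<open>k\<close> lies in exactly one block, so the product of block
  integrals is linear in the factor at \<open>k\<close>, just as the integral over the union is.
  Integrating the hypothesis at \<open>t = s u\<close> against \<open>g u\<close> therefore gives
  the claim.\<close>

lemma block_inequality_layered_step:
  fixes V :: "'i \<Rightarrow> 'a \<Rightarrow> real" and \<phi> :: "'i \<Rightarrow> real \<Rightarrow> ennreal" and B :: "'b \<Rightarrow> 'i set"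
  assumes M: "sigma_finite_measure M"
    and K: "finite K" "\<And>i. i \<in> K \<Longrightarrow> finite (B i)" "disjoint_family_on B K"
    and k: "k \<in> \<Union> (B ` K)"
    and V: "\<And>j. j \<in> \<Union> (B ` K) \<Longrightarrow> V j \<in> borel_measurable M"
    and \<phi>: "\<And>j. j \<in> \<Union> (B ` K) \<Longrightarrow> \<phi> j \<in> borel_measurable borel"
    and g: "g \<in> borel_measurable borel"
    and s: "s \<in> borel_measurable borel"
    and le: "\<And>t. (\<Prod>i\<in>K. \<integral>\<^sup>+\<omega>. (\<Prod>j\<in>B i. (\<phi>(k := indicator {t..})) j (V j \<omega>)) \<partial>M)
      \<le> (\<integral>\<^sup>+\<omega>. (\<Prod>j\<in>\<Union> (B ` K). (\<phi>(k := indicator {t..})) j (V j \<omega>)) \<partial>M)"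
  shows "(\<Prod>i\<in>K. \<integral>\<^sup>+\<omega>. (\<Prod>j\<in>B i. (\<phi>(k := layered g s)) j (V j \<omega>)) \<partial>M)
      \<le> (\<integral>\<^sup>+\<omega>. (\<Prod>j\<in>\<Union> (B ` K). (\<phi>(k := layered g s)) j (V j \<omega>)) \<partial>M)"
proof -
  define E where "E h A = (\<integral>\<^sup>+\<omega>. (\<Prod>j\<in>A. (\<phi>(k := h)) j (V j \<omega>)) \<partial>M)" for h A
  obtain i0 where i0: "i0 \<in> K" "k \<in> B i0"
    using k by blast
  \<comment> \<open>Blocks other than \<open>B i0\<close> do not see the factor at \<open>k\<close>;
    \<open>\<phi> k\<close> is an arbitrary filler, which makes \<open>C\<close> independent of the
    layer.\<close>
  define C where "C = (\<Prod>i\<in>K - {i0}. E (\<phi> k) (B i))"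
  have other: "E h (B i) = E (\<phi> k) (B i)" if "i \<in> K - {i0}" for h i
  proof -
    have "k \<notin> B i"
      using that i0 K(3) by (auto simp: disjoint_family_on_def)
    then have "(\<Prod>j\<in>B i. (\<phi>(k := h)) j (V j \<omega>)) = (\<Prod>j\<in>B i. (\<phi>(k := \<phi> k)) j (V j \<omega>))" for \<omega>
      by (intro prod.cong) auto
    then show ?thesis
      unfolding E_def by simp
  qed
  have split: "(\<Prod>i\<in>K. E h (B i)) = E h (B i0) * C" for h
    unfolding C_def prod.remove[OF K(1) i0(1)] by (intro arg_cong2[where f = "(*)"] prod.cong refl other)
  have mix: "E (layered g s) A = (\<integral>\<^sup>+u. g u * E (indicator {s u..}) A \<partial>lborel)"
    "(\<lambda>u. E (indicator {s u..}) A) \<in> borel_measurable lborel"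
    if "finite A" "k \<in> A" "A \<subseteq> \<Union> (B ` K)" for A
    unfolding E_def
    by (rule nn_integral_prod_layered[OF M that(1,2) V \<phi> g s]; use that in blast)+
  have B0: "finite (B i0)" "B i0 \<subseteq> \<Union> (B ` K)"
    using K i0 by auto
  note [measurable] = mix(2)[OF B0(1) i0(2) B0(2)] g
  have "(\<Prod>i\<in>K. E (layered g s) (B i)) = (\<integral>\<^sup>+u. g u * E (indicator {s u..}) (B i0) \<partial>lborel) * C"
    unfolding split mix(1)[OF B0(1) i0(2) B0(2)] ..
  also have "\<dots> = (\<integral>\<^sup>+u. g u * (\<Prod>i\<in>K. E (indicator {s u..}) (B i)) \<partial>lborel)"
    unfolding split by (subst nn_integral_multc[symmetric]) (simp_all add: mult.assoc)
  \<comment> \<open>The hypothesis is applied pointwise in \<open>u\<close>, with threshold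
    \<open>s u\<close>.\<close>
  also have "\<dots> \<le> (\<integral>\<^sup>+u. g u * E (indicator {s u..}) (\<Union> (B ` K)) \<partial>lborel)"
    using le unfolding E_def by (intro nn_integral_mono mult_left_mono) auto
  also have "\<dots> = E (layered g s) (\<Union> (B ` K))"
    using K(1,2) k by (intro mix(1)[symmetric]) auto
  finally show ?thesis
    unfolding E_def .
qed

text \<open>Induction on the set of coordinates whose indicator has already been replaced: the empty
  set is the dependence hypothesis, the full set the conclusion.\<close>

lemma block_inequality_layered:
  fixes V :: "'i \<Rightarrow> 'a \<Rightarrow> real" and g :: "'i \<Rightarrow> real \<Rightarrow> ennreal" and s :: "'i \<Rightarrow> real \<Rightarrow> real"
    and B :: "'b \<Rightarrow> 'i set"
  assumes M: "sigma_finite_measure M"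
    and K: "finite K" "\<And>i. i \<in> K \<Longrightarrow> finite (B i)" "disjoint_family_on B K"
    and V: "\<And>j. j \<in> \<Union> (B ` K) \<Longrightarrow> V j \<in> borel_measurable M"
    and g: "\<And>j. j \<in> \<Union> (B ` K) \<Longrightarrow> g j \<in> borel_measurable borel"
    and s: "\<And>j. j \<in> \<Union> (B ` K) \<Longrightarrow> s j \<in> borel_measurable borel"
    and le: "\<And>t. (\<Prod>i\<in>K. emeasure M {\<omega> \<in> space M. \<forall>j\<in>B i. t j \<le> V j \<omega>})
      \<le> emeasure M {\<omega> \<in> space M. \<forall>j\<in>\<Union> (B ` K). t j \<le> V j \<omega>}"
  shows "(\<Prod>i\<in>K. \<integral>\<^sup>+\<omega>. (\<Prod>j\<in>B i. layered (g j) (s j) (V j \<omega>)) \<partial>M)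
      \<le> (\<integral>\<^sup>+\<omega>. (\<Prod>j\<in>\<Union> (B ` K). layered (g j) (s j) (V j \<omega>)) \<partial>M)"
proof -
  define J where "J = \<Union> (B ` K)"
  have J: "B i \<subseteq> J" if "i \<in> K" for i
    using that unfolding J_def by auto
  have finJ: "finite J"
    using K unfolding J_def by blast
  \<comment> \<open>The interpolating family: coordinates in \<open>S\<close> carry the layered
    factor, the others still the indicator with threshold \<open>t j\<close>.\<close>
  define \<phi> where
    "\<phi> S t j = (if j \<in> S then layered (g j) (s j) else indicator {t j..})"
    for S and t :: "'i \<Rightarrow> real" and j
  \<comment> \<open>A product of threshold indicators is the indicator of the joint event; for empty
    \<open>A\<close> both sides are the total mass.\<close>
  have base: "(\<integral>\<^sup>+\<omega>. (\<Prod>j\<in>A. \<phi> {} t j (V j \<omega>)) \<partial>M) = emeasure M {\<omega> \<in> space M. \<forall>j\<in>A. t j \<le> V j \<omega>}"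
    if A: "A \<subseteq> J" for A t
  proof -
    have fin: "finite A"
      using A finJ finite_subset by blast
    have sets: "{\<omega> \<in> space M. \<forall>j\<in>A. t j \<le> V j \<omega>} \<in> sets M"
    proof (intro sets.sets_Collect_finite_All fin)
      show "{\<omega> \<in> space M. t j \<le> V j \<omega>} \<in> sets M" if "j \<in> A" for j
      proof -
        have [measurable]: "V j \<in> borel_measurable M"
          using A that by (intro V) (auto simp: J_def)
        show ?thesis
          by measurable
      qed
    qed
    have "(\<Prod>j\<in>A. \<phi> {} t j (V j \<omega>)) = indicator {\<omega> \<in> space M. \<forall>j\<in>A. t j \<le> V j \<omega>} \<omega>"
      if "\<omega> \<in> space M" for \<omega>
    proof (cases "\<forall>j\<in>A. t j \<le> V j \<omega>")
      case True
      then show ?thesis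
        using that by (simp add: \<phi>_def)
    next
      case False
      then show ?thesis
        using that fin by (auto simp: \<phi>_def indicator_def intro!: prod_zero)
    qed
    then have "(\<integral>\<^sup>+\<omega>. (\<Prod>j\<in>A. \<phi> {} t j (V j \<omega>)) \<partial>M) =
        (\<integral>\<^sup>+\<omega>. indicator {\<omega> \<in> space M. \<forall>j\<in>A. t j \<le> V j \<omega>} \<omega> \<partial>M)"
      by (rule nn_integral_cong)
    then show ?thesis
      using sets by simp
  qed
  have "(\<Prod>i\<in>K. \<integral>\<^sup>+\<omega>. (\<Prod>j\<in>B i. \<phi> S t j (V j \<omega>)) \<partial>M)
      \<le> (\<integral>\<^sup>+\<omega>. (\<Prod>j\<in>J. \<phi> S t j (V j \<omega>)) \<partial>M)" if "finite S" "S \<subseteq> J" for S t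
    using that
  proof (induction S arbitrary: t rule: finite_induct)
    case empty
    have "(\<Prod>i\<in>K. \<integral>\<^sup>+\<omega>. (\<Prod>j\<in>B i. \<phi> {} t j (V j \<omega>)) \<partial>M)
        = (\<Prod>i\<in>K. emeasure M {\<omega> \<in> space M. \<forall>j\<in>B i. t j \<le> V j \<omega>})"
      by (intro prod.cong refl base J)
    also have "\<dots> \<le> emeasure M {\<omega> \<in> space M. \<forall>j\<in>J. t j \<le> V j \<omega>}"
      unfolding J_def by (rule le)
    finally show ?case
      unfolding base[OF subset_refl] .
  next
    case (insert k S)
    \<comment> \<open>Since \<open>k\<close> is not in \<open>S\<close>, prescribing an indicator at
      \<open>k\<close> only changes the threshold there. The induction hypothesis covers this
      because it holds for all \<open>t\<close>.\<close>
    have upd: "(\<phi> S t)(k := indicator {c..}) = \<phi> S (t(k := c))" for c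
      using insert.hyps by (auto simp: \<phi>_def fun_eq_iff)
    have ins: "(\<phi> S t)(k := layered (g k) (s k)) = \<phi> (insert k S) t"
      by (auto simp: \<phi>_def fun_eq_iff)
    have \<phi>_meas: "\<phi> S t j \<in> borel_measurable borel" if "j \<in> \<Union> (B ` K)" for j
      using g[OF that] s[OF that] by (auto simp: \<phi>_def)
    have k: "k \<in> \<Union> (B ` K)"
      using insert.prems by (simp add: J_def)
    have IH: "(\<Prod>i\<in>K. \<integral>\<^sup>+\<omega>. (\<Prod>j\<in>B i. \<phi> S t' j (V j \<omega>)) \<partial>M)
        \<le> (\<integral>\<^sup>+\<omega>. (\<Prod>j\<in>J. \<phi> S t' j (V j \<omega>)) \<partial>M)" for t'
      by (rule insert.IH) (use insert.prems in simp)
    show ?case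
      unfolding ins[symmetric] J_def
      by (rule block_inequality_layered_step[OF M K k V \<phi>_meas g[OF k] s[OF k]])
        (simp_all only: upd IH[unfolded J_def])
  qed
  note main = this[OF finJ subset_refl]
  have full: "(\<Prod>j\<in>A. \<phi> J t j (V j \<omega>)) = (\<Prod>j\<in>A. layered (g j) (s j) (V j \<omega>))"
    if "A \<subseteq> J" for A t \<omega>
    by (intro prod.cong refl) (use that in \<open>auto simp: \<phi>_def\<close>)
  \<comment> \<open>Once all of \<open>J\<close> is replaced, no threshold \<open>t j\<close> occurs
    any more, so \<open>undefined\<close> can stand for \<open>t\<close>.\<close>
  have "(\<Prod>i\<in>K. \<integral>\<^sup>+\<omega>. (\<Prod>j\<in>B i. layered (g j) (s j) (V j \<omega>)) \<partial>M)
      = (\<Prod>i\<in>K. \<integral>\<^sup>+\<omega>. (\<Prod>j\<in>B i. \<phi> J undefined j (V j \<omega>)) \<partial>M)"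
    by (intro prod.cong refl nn_integral_cong full[symmetric] J)
  also have "\<dots> \<le> (\<integral>\<^sup>+\<omega>. (\<Prod>j\<in>J. layered (g j) (s j) (V j \<omega>)) \<partial>M)"
    using main[of undefined] unfolding full[OF subset_refl] .
  finally show ?thesis
    unfolding J_def .
qed

section \<open>Layer representation of real powers\<close>

lemma powr_le_iff_le_powr_inverse:
  fixes u x a :: real
  assumes "0 < u" "0 \<le> x" "0 < a"
  shows "u powr (1 / a) \<le> x \<longleftrightarrow> u \<le> x powr a"
proof
  assume "u powr (1 / a) \<le> x"
  then have "(u powr (1 / a)) powr a \<le> x powr a"
    using assms by (intro powr_mono2) auto
  then show "u \<le> x powr a"
    using assms by (simp add: powr_powr)
next
  assume "u \<le> x powr a"
  then have "u powr (1 / a) \<le> (x powr a) powr (1 / a)"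
    using assms by (intro powr_mono2) auto
  then show "u powr (1 / a) \<le> x"
    using assms by (simp add: powr_powr)
qed

text \<open>For \<open>a = 0\<close> the constant 1 arises as the mass of the unit interval with
  threshold 0, which every nonnegative point passes. For \<open>a > 0\<close> the weight restricts
  to levels \<open>u > 0\<close>, where \<open>u \<le> x powr a\<close> is equivalent to a threshold
  on \<open>x\<close>.\<close>

definition rpow_weight :: "real \<Rightarrow> real \<Rightarrow> ennreal" where
  "rpow_weight a = indicator (if a = 0 then {0..1} else {0<..})"

definition rpow_threshold :: "real \<Rightarrow> real \<Rightarrow> real" where
  "rpow_threshold a u = (if a = 0 then 0 else u powr (1 / a))"

lemma rpow_eq_layered:
  assumes "0 \<le> x" "0 \<le> a"
  shows "ennreal (rpow x a) = layered (rpow_weight a) (rpow_threshold a) x"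
proof (cases "a = 0")
  case True
  then show ?thesis
    using assms by (simp add: rpow_def layered_def rpow_weight_def rpow_threshold_def)
next
  case False
  \<comment> \<open>The layers that count are those with \<open>0 < u \<le> x powr a\<close>, an
    interval of length \<open>x powr a\<close>.\<close>
  with assms have "rpow_weight a u * indicator {rpow_threshold a u..} x
      = indicator {0<..x powr a} u" for u
    by (auto simp: rpow_weight_def rpow_threshold_def powr_le_iff_le_powr_inverse indicator_def)
  with False show ?thesis
    by (simp add: rpow_def layered_def)
qed

lemma measurable_rpow_weight [measurable]: "rpow_weight a \<in> borel_measurable borel"
  unfolding rpow_weight_def by simp

lemma measurable_rpow_threshold [measurable]: "rpow_threshold a \<in> borel_measurable borel"
  unfolding rpow_threshold_def by simp

lemma rpow_nonneg: "0 \<le> rpow x a"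
  by (simp add: rpow_def)

section \<open>From block probabilities to moments\<close>

text \<open>The sign condition on \<open>V\<close> is there because powers are represented by layers
  at nonnegative points. As \<open>M\<close> is finite, the real probabilities in \<open>le\<close>
  translate into \<open>emeasure\<close>.\<close>

lemma block_inequality_rpow:
  fixes V :: "'i \<Rightarrow> 'a \<Rightarrow> real" and n :: "'i \<Rightarrow> real" and B :: "'b \<Rightarrow> 'i set"
  assumes M: "prob_space M"
    and K: "finite K" "\<And>i. i \<in> K \<Longrightarrow> finite (B i)" "disjoint_family_on B K"
    and V: "\<And>j. j \<in> \<Union> (B ` K) \<Longrightarrow> V j \<in> borel_measurable M"
    and nonneg: "\<And>j \<omega>. 0 \<le> V j \<omega>"
    and n: "\<And>j. j \<in> \<Union> (B ` K) \<Longrightarrow> 0 \<le> n j"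
    and le: "\<And>t. (\<Prod>i\<in>K. \<P>(\<omega> in M. \<forall>j\<in>B i. t j \<le> V j \<omega>))
      \<le> \<P>(\<omega> in M. \<forall>j\<in>\<Union> (B ` K). t j \<le> V j \<omega>)"
  shows "(\<Prod>i\<in>K. \<integral>\<^sup>+\<omega>. ennreal (\<Prod>j\<in>B i. rpow (V j \<omega>) (n j)) \<partial>M)
      \<le> (\<integral>\<^sup>+\<omega>. ennreal (\<Prod>j\<in>\<Union> (B ` K). rpow (V j \<omega>) (n j)) \<partial>M)"
proof -
  interpret prob_space M by fact
  have eq: "ennreal (\<Prod>j\<in>A. rpow (V j \<omega>) (n j)) =
      (\<Prod>j\<in>A. layered (rpow_weight (n j)) (rpow_threshold (n j)) (V j \<omega>))"
    if "A \<subseteq> \<Union> (B ` K)" for A \<omega>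
    unfolding prod_ennreal[OF rpow_nonneg, symmetric]
    by (intro prod.cong refl rpow_eq_layered nonneg n) (use that in blast)
  have "(\<Prod>i\<in>K. \<integral>\<^sup>+\<omega>. (\<Prod>j\<in>B i. layered (rpow_weight (n j)) (rpow_threshold (n j)) (V j \<omega>)) \<partial>M)
      \<le> (\<integral>\<^sup>+\<omega>. (\<Prod>j\<in>\<Union> (B ` K). layered (rpow_weight (n j)) (rpow_threshold (n j)) (V j \<omega>)) \<partial>M)"
    using le
    by (intro block_inequality_layered sigma_finite_measure_axioms K V)
      (simp_all add: emeasure_eq_measure prod_ennreal)
  \<comment> \<open>The rewriting \<open>eq\<close> applies only to subsets of the union, so it is
    prepared for a block with \<open>i \<in> K\<close>, a fact that \<open>prod.cong\<close>
    supplies.\<close>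
  moreover have "(\<integral>\<^sup>+\<omega>. ennreal (\<Prod>j\<in>B i. rpow (V j \<omega>) (n j)) \<partial>M) =
      (\<integral>\<^sup>+\<omega>. (\<Prod>j\<in>B i. layered (rpow_weight (n j)) (rpow_threshold (n j)) (V j \<omega>)) \<partial>M)"
    if "i \<in> K" for i
    using that by (subst eq) auto
  ultimately show ?thesis
    by (simp add: eq cong: prod.cong)
qed

theorem theorem3p2:
  fixes M :: "'a measure" and d :: nat and n :: "nat \<Rightarrow> real" and X :: "nat \<Rightarrow> 'a \<Rightarrow> real"
  assumes "prob_space M"
    and "d \<ge> 1"
    and "\<And>j. j \<in> {1..d} \<Longrightarrow> n j \<ge> 0"
    and "random_vector M d X"
    and "(\<integral>\<^sup>+\<omega>. ennreal (\<Prod>j\<in>{1..d}. rpow \<bar>X j \<omega>\<bar> (n j)) \<partial>M) < \<infinity>"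
  shows "(PUOD M d (\<lambda>j \<omega>. \<bar>X j \<omega>\<bar>) \<longrightarrow>
           (\<integral>\<^sup>+\<omega>. ennreal (\<Prod>j\<in>{1..d}. rpow \<bar>X j \<omega>\<bar> (n j)) \<partial>M)
             \<ge> (\<Prod>j\<in>{1..d}. \<integral>\<^sup>+\<omega>. ennreal (rpow \<bar>X j \<omega>\<bar> (n j)) \<partial>M)) \<and>
         (SPUOD M d (\<lambda>j \<omega>. \<bar>X j \<omega>\<bar>) \<longrightarrow>
           (\<forall>I \<subseteq> {1..d}.
             (\<integral>\<^sup>+\<omega>. ennreal (\<Prod>j\<in>{1..d}. rpow \<bar>X j \<omega>\<bar> (n j)) \<partial>M)
               \<ge> (\<integral>\<^sup>+\<omega>. ennreal (\<Prod>j\<in>I. rpow \<bar>X j \<omega>\<bar> (n j)) \<partial>M)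
                 * (\<integral>\<^sup>+\<omega>. ennreal (\<Prod>j\<in>{1..d} - I. rpow \<bar>X j \<omega>\<bar> (n j)) \<partial>M)))"
proof (intro conjI impI allI)
  have X: "(\<lambda>\<omega>. \<bar>X j \<omega>\<bar>) \<in> borel_measurable M" if "j \<in> {1..d}" for j
    by (rule borel_measurable_abs) (use assms(4) that in \<open>auto simp: random_vector_def\<close>)
  {
    assume "PUOD M d (\<lambda>j \<omega>. \<bar>X j \<omega>\<bar>)"
    \<comment> \<open>With singleton blocks the joint event of a block is the marginal event and
      each inner product is a single power.\<close>
    then show "(\<integral>\<^sup>+\<omega>. ennreal (\<Prod>j\<in>{1..d}. rpow \<bar>X j \<omega>\<bar> (n j)) \<partial>M)
        \<ge> (\<Prod>j\<in>{1..d}. \<integral>\<^sup>+\<omega>. ennreal (rpow \<bar>X j \<omega>\<bar> (n j)) \<partial>M)"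
      using block_inequality_rpow[OF assms(1), where K = "{1..d}" and B = "\<lambda>j. {j}"
          and V = "\<lambda>j \<omega>. \<bar>X j \<omega>\<bar>" and n = n] X assms(3)
      by (simp add: PUOD_def disjoint_family_on_def)
  next
    fix I
    assume S: "SPUOD M d (\<lambda>j \<omega>. \<bar>X j \<omega>\<bar>)" and I: "I \<subseteq> {1..d}"
    \<comment> \<open>Two blocks indexed by \<open>bool\<close>. Either may be empty; its event then
      has probability 1 and its product is 1.\<close>
    define B where "B b = (if b then I else {1..d} - I)" for b
    have U: "\<Union> (B ` UNIV) = {1..d}"
      using I by (auto simp: B_def UNIV_bool)
    have "(\<Prod>b\<in>UNIV. \<integral>\<^sup>+\<omega>. ennreal (\<Prod>j\<in>B b. rpow \<bar>X j \<omega>\<bar> (n j)) \<partial>M)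
        \<le> (\<integral>\<^sup>+\<omega>. ennreal (\<Prod>j\<in>\<Union> (B ` UNIV). rpow \<bar>X j \<omega>\<bar> (n j)) \<partial>M)"
    proof (rule block_inequality_rpow[OF assms(1)])
      show "finite (B b)" for b
        using I finite_subset by (auto simp: B_def)
      show "disjoint_family_on B UNIV"
        by (auto simp: disjoint_family_on_def B_def)
      show "(\<Prod>b\<in>UNIV. \<P>(\<omega> in M. \<forall>j\<in>B b. t j \<le> \<bar>X j \<omega>\<bar>))
          \<le> \<P>(\<omega> in M. \<forall>j\<in>\<Union> (B ` UNIV). t j \<le> \<bar>X j \<omega>\<bar>)" for t
        using S I unfolding U by (simp add: SPUOD_def B_def UNIV_bool mult.commute)
    qed (use X assms(3) in \<open>auto simp: U\<close>)
    then show "(\<integral>\<^sup>+\<omega>. ennreal (\<Prod>j\<in>{1..d}. rpow \<bar>X j \<omega>\<bar> (n j)) \<partial>M)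
        \<ge> (\<integral>\<^sup>+\<omega>. ennreal (\<Prod>j\<in>I. rpow \<bar>X j \<omega>\<bar> (n j)) \<partial>M)
          * (\<integral>\<^sup>+\<omega>. ennreal (\<Prod>j\<in>{1..d} - I. rpow \<bar>X j \<omega>\<bar> (n j)) \<partial>M)"
      unfolding U by (simp add: B_def UNIV_bool mult.commute)
  }
qed

end
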